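(* Let $n:\mathbb{Z}$ with $\mathsf{is\_prime}\,n$. Then $\overline{\exists}_{\lambda m.\,m=n}\,\mathsf{sieve}$ holds, i.e., there is $i$ such that the finite list $\mathsf{idl}\,\mathsf{sieve}\,i$ contains an element equal to $n$.
   Context: $\mathsf{colist}\,A$ is the coinductive type with constructors $\bot$ and $\mathsf{cocons}\,a\,l$, ordered coinductively by $\bot\sqsubseteq l$ and $\mathsf{cocons}\,a\,l_1\sqsubseteq\mathsf{cocons}\,a\,l_2$ if $l_1\sqsubseteq l_2$; order-equivalent streams are assumed equal (axiom). Lists $\mathsf{list}\,A$ are ordered by prefix. $\mathsf{idl}\,s\,0=\mathsf{nil}$, $\mathsf{idl}\,\bot\,(i+1)=\mathsf{nil}$, $\mathsf{idl}(\mathsf{cocons}\,a\,s)(i+1)=\mathsf{cons}\,a\,(\mathsf{idl}\,s\,i)$. For monotone $h:\mathsf{list}\,A\to C$, the continuous extension is $\overline h(s):=\sup_i h(\mathsf{idl}\,s\,i)$ (chosen supremum). $\mathsf{fold}\,z\,f$: $\mathsf{nil}\mapsto z$, $\mathsf{cons}\,a\,l\mapsto f\,a\,(\mathsf{fold}\,z\,f\,l)$. $\mathsf{filter}\,f:=\overline{\mathsf{fold}\,\bot\,(\lambda a\,l.\,\text{if }f\,a\text{ then }\mathsf{cocons}\,a\,l\text{ else }l)}:\mathsf{colist}\,A\to\mathsf{colist}\,A$ for $f:A\to\mathbb{B}$. $\mathsf{nats}\,n:=\mathsf{cocons}\,n\,(\mathsf{nats}(n+1))$ (corecursively, $n:\mathbb{Z}$).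 $\mathsf{sieve\_aux}:=\overline{\mathsf{fold}\,\bot\,(\lambda n\,l.\,\mathsf{cocons}\,n\,(\mathsf{filter}\,(\lambda m.\,m\bmod n\ne0)\,l))}$ and $\mathsf{sieve}:=\mathsf{sieve\_aux}(\mathsf{nats}\,2):\mathsf{colist}\,\mathbb{Z}$. $\mathsf{is\_prime}\,n :\iff 1<n\land\forall m,\ 1<m\to n\ne m\to n\bmod m\ne 0$. For $P:A\to\mathbb{P}$, $\overline{\exists}_P\,s :\iff \exists i,\ \mathsf{fold}\,\bot\,(\lambda a\,Q.\,P\,a\lor Q)\,(\mathsf{idl}\,s\,i)$ (the continuous extension into $\mathbb{P}$, whose suprema are existentials). *)

theory Defs
  imports Main "HOL-Library.Sublist"
begin

codatatype 'a colist = CoBot | CoCons 'a "'a colist"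

coinductive colist_le :: "'a colist \<Rightarrow> 'a colist \<Rightarrow> bool" where
  colist_le_CoBot: "colist_le CoBot l"
| colist_le_CoCons: "colist_le l1 l2 \<Longrightarrow> colist_le (CoCons a l1) (CoCons a l2)"

inductive_cases colist_le_CoConsE: "colist_le (CoCons a l) r"
inductive_cases colist_le_to_CoBotE: "colist_le l CoBot"
inductive_cases colist_le_CoCons_CoConsE: "colist_le (CoCons a l) (CoCons b r)"

lemma colist_le_refl: "colist_le l l"
proof -
  have "l = r \<Longrightarrow> colist_le l r" for r :: "'a colist"
    by (coinduction arbitrary: l r) (metis colist.exhaust)
  then show ?thesis by simp
qed

lemma colist_le_trans: "colist_le l m \<Longrightarrow> colist_le m r \<Longrightarrow> colist_le l r"
proof (coinduction arbitrary: l m r)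
  case colist_le
  then show ?case
    by (cases rule: colist_le.cases) (auto elim: colist_le_CoConsE)
qed

lemma colist_le_antisym: "colist_le l r \<Longrightarrow> colist_le r l \<Longrightarrow> l = r"
proof (coinduction arbitrary: l r)
  case Eq_colist
  then show ?case
    by (cases rule: colist_le.cases) (auto elim: colist_le_to_CoBotE colist_le_CoCons_CoConsE)
qed

text \<open>
  The supremum is only meaningful on chains: there all non-bottom elements have the same head,
  so that the choice of the head is unique.
\<close>

primcorec colist_Sup :: "'a colist set \<Rightarrow> 'a colist" where
  "colist_Sup A =
    (if \<forall>l\<in>A. l = CoBot then CoBot
     else CoCons (SOME a. \<exists>l. CoCons a l \<in> A) (colist_Sup {l. \<exists>a. CoCons a l \<in> A}))"

lemma colist_chain_head:
  assumes "Complete_Partial_Order.chain colist_le A" "CoCons a l \<in> A"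
  shows "(SOME a. \<exists>l. CoCons a l \<in> A) = a"
proof (rule some_equality)
  show "\<exists>l. CoCons a l \<in> A" using assms(2) by blast
next
  fix b assume "\<exists>l. CoCons b l \<in> A"
  then obtain r where "CoCons b r \<in> A" by blast
  from chainD[OF assms(1) this assms(2)] show "b = a"
    by (auto elim: colist_le_CoCons_CoConsE)
qed

lemma colist_chain_tails:
  assumes "Complete_Partial_Order.chain colist_le A"
  shows "Complete_Partial_Order.chain colist_le {l. \<exists>a. CoCons a l \<in> A}"
proof (rule chainI)
  fix x y assume "x \<in> {l. \<exists>a. CoCons a l \<in> A}" "y \<in> {l. \<exists>a. CoCons a l \<in> A}"
  then obtain a b where "CoCons a x \<in> A" "CoCons b y \<in> A" by blast
  from chainD[OF assms this] show "colist_le x y \<or> colist_le y x"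
    by (auto elim: colist_le_CoCons_CoConsE)
qed

lemma colist_Sup_CoCons:
  assumes "Complete_Partial_Order.chain colist_le A" "CoCons a l \<in> A"
  shows "colist_Sup A = CoCons a (colist_Sup {l. \<exists>a. CoCons a l \<in> A})"
proof -
  have "\<not> (\<forall>l\<in>A. l = CoBot)" using assms(2) by blast
  then show ?thesis
    by (subst colist_Sup.code) (simp add: colist_chain_head[OF assms])
qed

lemma colist_Sup_upper:
  "Complete_Partial_Order.chain colist_le A \<Longrightarrow> l \<in> A \<Longrightarrow> colist_le l (colist_Sup A)"
proof (coinduction arbitrary: l A)
  case colist_le
  show ?case
  proof (cases l)
    case (CoCons a r)
    with colist_le colist_Sup_CoCons[of A a r] colist_chain_tails[of A] show ?thesis
      by blast
  qed simp
qed

lemma colist_Sup_least: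
  "Complete_Partial_Order.chain colist_le A \<Longrightarrow> (\<And>l. l \<in> A \<Longrightarrow> colist_le l z)
    \<Longrightarrow> colist_le (colist_Sup A) z"
proof (coinduction arbitrary: A z)
  case colist_le
  show ?case
  proof (cases "\<forall>l\<in>A. l = CoBot")
    case True
    then have "colist_Sup A = CoBot" by (subst colist_Sup.code) simp
    then show ?thesis by simp
  next
    case False
    then obtain a l where l: "CoCons a l \<in> A" by (metis colist.exhaust)
    from colist_le(2) l have "colist_le (CoCons a l) z" by blast
    then obtain y where z: "z = CoCons a y"
      by (auto elim: colist_le_CoConsE)
    have "colist_le x y" if "\<exists>b. CoCons b x \<in> A" for x
      using that colist_le(2) z by (auto elim: colist_le_CoCons_CoConsE)
    then show ?thesis
      using colist_Sup_CoCons[OF colist_le(1) l] z colist_chain_tails[OF colist_le(1)] by blast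
  qed
qed

instantiation colist :: (type) ccpo
begin

definition less_eq_colist :: "'a colist \<Rightarrow> 'a colist \<Rightarrow> bool" where
  "less_eq_colist = colist_le"

definition less_colist :: "'a colist \<Rightarrow> 'a colist \<Rightarrow> bool" where
  "less_colist l r \<longleftrightarrow> l \<le> r \<and> \<not> r \<le> l"

definition Sup_colist :: "'a colist set \<Rightarrow> 'a colist" where
  "Sup_colist = colist_Sup"

instance
proof
qed (auto simp: less_eq_colist_def less_colist_def Sup_colist_def
      intro: colist_le_refl colist_le_trans colist_le_antisym colist_Sup_upper colist_Sup_least)

end

fun idl :: "'a colist \<Rightarrow> nat \<Rightarrow> 'a list" where
  "idl s 0 = []"
| "idl CoBot (Suc i) = []"
| "idl (CoCons a s) (Suc i) = a # idl s i"

lemma prefix_idl: "i \<le> j \<Longrightarrow> prefix (idl s i) (idl s j)"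
proof (induction i arbitrary: s j)
  case (Suc i)
  then obtain k where "j = Suc k" "i \<le> k" by (cases j) auto
  with Suc.IH show ?case by (cases s) auto
qed simp

text \<open>
  The continuous extension is meant for \<open>h\<close> monotone from the prefix order; only then is the
  supremum taken over a chain.
\<close>

definition cont_ext :: "('a list \<Rightarrow> 'c::ccpo) \<Rightarrow> 'a colist \<Rightarrow> 'c" where
  "cont_ext h s = (SUP i. h (idl s i))"

lemma chain_idl:
  fixes h :: "'a list \<Rightarrow> 'c::ccpo"
  assumes "monotone prefix (\<le>) h"
  shows "Complete_Partial_Order.chain (\<le>) (range (\<lambda>i. h (idl s i)))"
proof (rule chainI)
  fix x y assume "x \<in> range (\<lambda>i. h (idl s i))" "y \<in> range (\<lambda>i. h (idl s i))"
  then obtain i j where "x = h (idl s i)" "y = h (idl s j)" by blast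
  then show "x \<le> y \<or> y \<le> x"
    using nat_le_linear[of i j] prefix_idl monotoneD[OF assms] by blast
qed

text \<open>The fold \<open>nil \<mapsto> z\<close>, \<open>cons a l \<mapsto> f a (fold z f l)\<close> is \<open>\<lambda>l. foldr f l z\<close>.\<close>

definition cofilter :: "('a \<Rightarrow> bool) \<Rightarrow> 'a colist \<Rightarrow> 'a colist" where
  "cofilter f = cont_ext (\<lambda>xs. foldr (\<lambda>a l. if f a then CoCons a l else l) xs CoBot)"

primcorec nats :: "int \<Rightarrow> int colist" where
  "nats n = CoCons n (nats (n + 1))"

definition sieve_aux :: "int colist \<Rightarrow> int colist" where
  "sieve_aux =
    cont_ext (\<lambda>xs. foldr (\<lambda>n l. CoCons n (cofilter (\<lambda>m. m mod n \<noteq> 0) l)) xs CoBot)"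

definition sieve :: "int colist" where
  "sieve = sieve_aux (nats 2)"

definition is_prime :: "int \<Rightarrow> bool" where
  "is_prime n \<longleftrightarrow> 1 < n \<and> (\<forall>m. 1 < m \<longrightarrow> n \<noteq> m \<longrightarrow> n mod m \<noteq> 0)"

definition co_ex :: "('a \<Rightarrow> bool) \<Rightarrow> 'a colist \<Rightarrow> bool" where
  "co_ex P s \<longleftrightarrow> (\<exists>i. foldr (\<lambda>a Q. P a \<or> Q) (idl s i) False)"

lemma co_ex_eq_cont_ext: "co_ex P = cont_ext (\<lambda>xs. foldr (\<lambda>a Q. P a \<or> Q) xs False)"
  by (auto simp: fun_eq_iff co_ex_def cont_ext_def)

lemma co_ex_iff: "co_ex P s \<longleftrightarrow> (\<exists>i. \<exists>a\<in>set (idl s i). P a)"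
proof -
  have "foldr (\<lambda>a Q. P a \<or> Q) xs False \<longleftrightarrow> (\<exists>a\<in>set xs. P a)" for xs
    by (induction xs) auto
  then show ?thesis by (simp add: co_ex_def)
qed

end

theory Submission
  imports Defs
begin

text \<open>
  Truth of \<open>co_ex P\<close> is preserved upwards in the order on streams, and every finite approximation
  of a continuous extension lies below it. Hence it is enough to run the sieve on a finite list of
  numbers greater than 1 that contains the prime \<open>n\<close>. There \<open>n\<close> survives every filter applied to
  it, since a filter stemming from a list element other than \<open>n\<close> only removes multiples of a number
  that does not divide \<open>n\<close>.
\<close>

lemma CoBot_least: "CoBot \<le> (s :: 'a colist)"
  by (simp add: less_eq_colist_def colist_le_CoBot)

lemma CoCons_mono: "s \<le> t \<Longrightarrow> CoCons a s \<le> CoCons a t"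
  by (simp add: less_eq_colist_def colist_le_CoCons)

lemma prefix_idl_mono:
  fixes s t :: "'a colist"
  assumes "s \<le> t"
  shows "prefix (idl s i) (idl t i)"
  using assms unfolding less_eq_colist_def
proof (induction i arbitrary: s t)
  case (Suc i)
  from Suc.prems show ?case
    by cases (auto intro: Suc.IH)
qed simp

lemma co_ex_mono:
  fixes s t :: "'a colist"
  assumes "s \<le> t" "co_ex P s"
  shows "co_ex P t"
  using assms prefix_idl_mono set_mono_prefix unfolding co_ex_iff by blast

lemma co_ex_CoCons: "co_ex P (CoCons a s) \<longleftrightarrow> P a \<or> co_ex P s"
proof
  assume "co_ex P (CoCons a s)"
  then obtain i b where "b \<in> set (idl (CoCons a s) i)" "P b"
    unfolding co_ex_iff by blast
  then show "P a \<or> co_ex P s"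
    unfolding co_ex_iff by (cases i) auto
next
  assume "P a \<or> co_ex P s"
  then obtain i where "\<exists>b\<in>set (idl (CoCons a s) (Suc i)). P b"
    unfolding co_ex_iff by auto
  then show "co_ex P (CoCons a s)"
    unfolding co_ex_iff by blast
qed

text \<open>Lengthening the list only replaces the innermost start value, the least element
  \<open>z\<close>, by something above it; the monotone steps carry this inequality
  outwards.\<close>

lemma monotone_foldr_prefix:
  fixes z :: "'c::order"
  assumes f: "\<And>a. mono (f a)" and z: "\<And>x. z \<le> x"
  shows "monotone prefix (\<le>) (\<lambda>xs. foldr f xs z)"
proof (rule monotoneI)
  fix xs ys :: "'a list"
  assume "prefix xs ys"
  then obtain zs where "ys = xs @ zs" by (auto simp: prefix_def)
  moreover have "foldr f xs z \<le> foldr f (xs @ zs) z"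
    by (induction xs) (auto intro: z monoD[OF f])
  ultimately show "foldr f xs z \<le> foldr f ys z" by simp
qed

lemma cont_ext_upper:
  assumes "monotone prefix (\<le>) h"
  shows "h (idl s i) \<le> cont_ext h s"
  unfolding cont_ext_def by (rule ccpo_Sup_upper[OF chain_idl[OF assms]]) simp

text \<open>Makes \<open>cofilter\<close> monotone, which the fold of the sieve needs because each
  of its steps applies a filter.\<close>

lemma mono_cont_ext:
  assumes h: "monotone prefix (\<le>) h"
  shows "mono (cont_ext h)"
proof (rule monoI)
  fix s t :: "'a colist"
  assume "s \<le> t"
  then have "h (idl s i) \<le> cont_ext h t" for i
    using monotoneD[OF h prefix_idl_mono] cont_ext_upper[OF h] order_trans by blast
  then show "cont_ext h s \<le> cont_ext h t"
    unfolding cont_ext_def[of h s] by (intro ccpo_Sup_least[OF chain_idl[OF h]]) auto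
qed

lemma monotone_cofilter_foldr:
  "monotone prefix (\<le>) (\<lambda>xs. foldr (\<lambda>a l. if f a then CoCons a l else l) xs CoBot)"
  by (rule monotone_foldr_prefix) (auto intro!: monoI CoCons_mono CoBot_least)

lemma mono_cofilter: "mono (cofilter f)"
  unfolding cofilter_def by (rule mono_cont_ext[OF monotone_cofilter_foldr])

text \<open>A witness already occurs in some finite \<open>idl s i\<close>; the fold over that list
  keeps it, and the result lies below \<open>cofilter f s\<close>.\<close>

lemma co_ex_cofilter:
  assumes "co_ex (\<lambda>a. f a \<and> P a) s"
  shows "co_ex P (cofilter f s)"
proof -
  let ?h = "\<lambda>xs. foldr (\<lambda>a l. if f a then CoCons a l else l) xs CoBot"
  obtain i a where "a \<in> set (idl s i)" "f a" "P a"
    using assms unfolding co_ex_iff by blast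
  moreover have "a \<in> set xs \<Longrightarrow> f a \<Longrightarrow> P a \<Longrightarrow> co_ex P (?h xs)" for xs
    by (induction xs) (auto simp: co_ex_CoCons)
  ultimately have "co_ex P (?h (idl s i))" by blast
  then show ?thesis
    using co_ex_mono cont_ext_upper[OF monotone_cofilter_foldr] unfolding cofilter_def by blast
qed

lemma monotone_sieve_foldr:
  "monotone prefix (\<le>)
    (\<lambda>xs. foldr (\<lambda>n l. CoCons n (cofilter (\<lambda>m::int. m mod n \<noteq> 0) l)) xs CoBot)"
  by (rule monotone_foldr_prefix) (auto intro!: monoI CoCons_mono CoBot_least monoD[OF mono_cofilter])

text \<open>Stated for arbitrary lists because the induction passes to tails, which no longer start
  at 2.\<close>

lemma co_ex_sieve_foldr:
  assumes "is_prime n" "n \<in> set xs" "\<forall>m\<in>set xs. 1 < m"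
  shows "co_ex (\<lambda>m. m = n)
    (foldr (\<lambda>n l. CoCons n (cofilter (\<lambda>m. m mod n \<noteq> 0) l)) xs CoBot)"
  using assms(2,3)
proof (induction xs)
  case (Cons a xs)
  let ?l = "foldr (\<lambda>n l. CoCons n (cofilter (\<lambda>m. m mod n \<noteq> 0) l)) xs CoBot"
  show ?case
  proof (cases "a = n")
    case False
    with Cons.prems assms(1) have "n mod a \<noteq> 0" by (auto simp: is_prime_def)
    moreover have "co_ex (\<lambda>m. m = n) ?l" using Cons False by auto
    \<comment> \<open>The witness is \<open>n\<close> itself, so the fact about
      \<open>n mod a\<close> can move inside the predicate, the form that
      \<open>co_ex_cofilter\<close> takes.\<close>
    ultimately have "co_ex (\<lambda>m. m mod a \<noteq> 0 \<and> m = n) ?l" unfolding co_ex_iff by blast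
    then show ?thesis by (simp add: co_ex_CoCons co_ex_cofilter)
  qed (simp add: co_ex_CoCons)
qed simp

lemma set_idl_nats: "set (idl (nats k) i) = {k..<k + int i}"
proof (induction i arbitrary: k)
  case (Suc i)
  then show ?case by (subst nats.code) auto
qed simp

theorem mainTheorem7:
  fixes n :: int
  assumes "is_prime n"
  shows "co_ex (\<lambda>m. m = n) sieve"
proof -
  \<comment> \<open>As \<open>n\<close> is positive, these are the numbers from 2 to
    \<open>n + 1\<close>, so \<open>n\<close> is among them.\<close>
  let ?xs = "idl (nats 2) (nat n)"
  have "n \<in> set ?xs" "\<forall>m\<in>set ?xs. 1 < m"
    using assms by (auto simp: set_idl_nats is_prime_def)
  from co_ex_sieve_foldr[OF assms this] show ?thesis
    unfolding sieve_def sieve_aux_def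
    by (rule co_ex_mono[OF cont_ext_upper[OF monotone_sieve_foldr]])
qed

end
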